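(* For every $\alpha\in[1,2)$ there exists a constant $c_\alpha^{\mathrm{det}}>0$ (depending only on $\alpha$) such that, for every $L,\tau,\Delta_0>0$ and every target accuracy $$\varepsilon\in\bigl(0,\;c_\alpha^{\mathrm{det}}\min\{\Delta_0,\,L^{\alpha/(2-\alpha)}\tau^{2/(2-\alpha)}\}\bigr],$$ one has $$T_\varepsilon\bigl(\mathcal F_{\alpha,L,\tau,\Delta_0}(0)\bigr)\ \ge\ c_\alpha^{\mathrm{det}}\,L\,\tau^{2/\alpha}\,\varepsilon^{-(2-\alpha)/\alpha}.$$
   Context: $\|\cdot\|$ is the Euclidean norm. For $f:\mathbb{R}^d\to\mathbb{R}$, $f_\star:=\inf_{x\in\mathbb{R}^d} f(x)$ and $S_0(f):=\{x\in\mathbb{R}^d: f(x)\le f(0)\}$. Function class. For $d\ge1$, $\mathcal F^{(d)}_{\alpha,L,\tau,\Delta_0}(0)$ is the set of all differentiable $f:\mathbb{R}^d\to\mathbb{R}$ such that $f_\star>-\infty$, $f(0)-f_\star\le\Delta_0$, $\nabla f$ is globally $L$-Lipschitz on $\mathbb{R}^d$, and $f(x)-f_\star\le\tau\|\nabla f(x)\|^\alpha$ for all $x\in S_0(f)$. Set $\mathcal F_{\alpha,L,\tau,\Delta_0}(0):=\bigcup_{d\ge1}\mathcal F^{(d)}_{\alpha,L,\tau,\Delta_0}(0)$. Deterministic first-order methods. A deterministic first-order method is a family $A=(A_d)_{d\ge1}$, one rule for each dimension. On input $f:\mathbb{R}^d\to\mathbb{R}$ it starts from $x_0=0$, and each query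 $x_t$ is a deterministic function of the previous oracle transcript $\{x_s,f(x_s),\nabla f(x_s):0\le s<t\}$. Write $x_0^A(f)=0,x_1^A(f),x_2^A(f),\dots$ for the resulting iterates. The fixed-budget minimax error is $$\mathcal E_T\bigl(\mathcal F_{\alpha,L,\tau,\Delta_0}(0)\bigr):=\inf_A\sup_{d\ge1}\sup_{f\in\mathcal F^{(d)}_{\alpha,L,\tau,\Delta_0}(0)}\bigl(f(x_T^A(f))-f_\star\bigr),$$ and the deterministic oracle complexity is $T_\varepsilon(\mathcal F_{\alpha,L,\tau,\Delta_0}(0)):=\inf\{T\ge0\ (T\text{ integer}):\mathcal E_T(\mathcal F_{\alpha,L,\tau,\Delta_0}(0))\le\varepsilon\}$. *)

theory Defs
  imports "HOL-Analysis.Analysis"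
begin

text \<open>
  The dimension is quantified inside the minimax error, so it cannot be a type parameter.
  All the spaces \<open>R^d\<close> are realised as the subspaces \<open>Rd d\<close> (coordinates \<open>0, ..., d - 1\<close>)
  of one inner product space: the finitely supported real sequences with the Euclidean inner product.
  A new type is needed because the library norm on \<open>poly_mapping\<close> is the sum norm.
\<close>

typedef fsvec = "{x :: nat \<Rightarrow> real. finite {i. x i \<noteq> 0}}"
  morphisms coord Abs_fsvec
  by (rule exI[of _ "\<lambda>_. 0"]) simp

setup_lifting type_definition_fsvec

lemma finite_coord: "finite {i. coord x i \<noteq> 0}"
  using coord[of x] by simp

lemma fsvec_eqI: "(\<And>i. coord x i = coord y i) \<Longrightarrow> x = y"
  by (simp add: coord_inject[symmetric] fun_eq_iff)

instantiation fsvec :: real_vector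
begin

lift_definition zero_fsvec :: fsvec is "\<lambda>_. 0" by simp

lift_definition plus_fsvec :: "fsvec \<Rightarrow> fsvec \<Rightarrow> fsvec" is "\<lambda>x y i. x i + y i"
  by (erule (1) rev_finite_subset[OF finite_UnI]) auto

lift_definition minus_fsvec :: "fsvec \<Rightarrow> fsvec \<Rightarrow> fsvec" is "\<lambda>x y i. x i - y i"
  by (erule (1) rev_finite_subset[OF finite_UnI]) auto

lift_definition uminus_fsvec :: "fsvec \<Rightarrow> fsvec" is "\<lambda>x i. - x i" by simp

lift_definition scaleR_fsvec :: "real \<Rightarrow> fsvec \<Rightarrow> fsvec" is "\<lambda>r x i. r * x i"
  by (erule rev_finite_subset) auto

instance
  by standard (transfer, simp add: algebra_simps)+

end

lemma coord_simps [simp]: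
  "coord 0 i = 0"
  "coord (x + y) i = coord x i + coord y i"
  "coord (x - y) i = coord x i - coord y i"
  "coord (- x) i = - coord x i"
  "coord (r *\<^sub>R x) i = r * coord x i"
  by (transfer, simp)+

instantiation fsvec :: real_inner
begin

definition inner_fsvec :: "fsvec \<Rightarrow> fsvec \<Rightarrow> real" where
  "inner (x :: fsvec) y = (\<Sum>i | coord x i \<noteq> 0. coord x i * coord y i)"

definition norm_fsvec :: "fsvec \<Rightarrow> real" where
  "norm (x :: fsvec) = sqrt (inner x x)"

definition dist_fsvec :: "fsvec \<Rightarrow> fsvec \<Rightarrow> real" where
  "dist (x :: fsvec) y = norm (x - y)"

definition sgn_fsvec :: "fsvec \<Rightarrow> fsvec" where
  "sgn (x :: fsvec) = x /\<^sub>R norm x"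

definition uniformity_fsvec :: "(fsvec \<times> fsvec) filter" where
  "uniformity = (INF e\<in>{0<..}. principal {(x, y :: fsvec). dist x y < e})"

definition open_fsvec :: "fsvec set \<Rightarrow> bool" where
  "open (U :: fsvec set) \<longleftrightarrow> (\<forall>x\<in>U. \<forall>\<^sub>F (x', y) in uniformity. x' = x \<longrightarrow> y \<in> U)"

lemma inner_fsvec_superset:
  assumes "finite S" "\<And>i. coord x i \<noteq> 0 \<Longrightarrow> coord y i \<noteq> 0 \<Longrightarrow> i \<in> S"
  shows "inner x y = (\<Sum>i\<in>S. coord x i * coord y i)"
proof -
  have "inner x y = (\<Sum>i\<in>S \<union> {i. coord x i \<noteq> 0}. coord x i * coord y i)"
    unfolding inner_fsvec_def using assms(1) finite_coord[of x]
    by (intro sum.mono_neutral_left) auto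
  also have "\<dots> = (\<Sum>i\<in>S. coord x i * coord y i)"
    using assms finite_coord[of x] by (intro sum.mono_neutral_right) auto
  finally show ?thesis .
qed

instance
proof
  fix x y z :: fsvec and r :: real
  show "inner x y = inner y x"
    by (subst inner_fsvec_superset[of "{i. coord y i \<noteq> 0}"])
       (auto simp: inner_fsvec_def finite_coord mult.commute)
  have fin: "finite {i. coord z i \<noteq> 0}" by (rule finite_coord)
  show "inner (x + y) z = inner x z + inner y z"
    by (simp add: inner_fsvec_superset[OF fin] distrib_right sum.distrib)
  show "inner (r *\<^sub>R x) y = r * inner x y"
    by (simp add: inner_fsvec_superset[OF finite_coord[of y]] sum_distrib_left mult.assoc)
  show "0 \<le> inner x x"
    by (simp add: inner_fsvec_def sum_nonneg)
  show "inner x x = 0 \<longleftrightarrow> x = 0"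
  proof
    assume "inner x x = 0"
    then have "\<forall>i\<in>{i. coord x i \<noteq> 0}. coord x i * coord x i = 0"
      using finite_coord[of x] by (simp add: inner_fsvec_def sum_nonneg_eq_0_iff)
    then show "x = 0" by (intro fsvec_eqI) auto
  qed (simp add: inner_fsvec_def)
qed (simp_all only: norm_fsvec_def dist_fsvec_def sgn_fsvec_def uniformity_fsvec_def open_fsvec_def)

end

definition Rd :: "nat \<Rightarrow> fsvec set" where
  "Rd d = {x. \<forall>i\<ge>d. coord x i = 0}"

lemma inner_Rd: "x \<in> Rd d \<Longrightarrow> inner x y = (\<Sum>i<d. coord x i * coord y i)"
  by (rule inner_fsvec_superset) (auto simp: Rd_def not_le[symmetric])

lemma norm_Rd: "x \<in> Rd d \<Longrightarrow> norm x = L2_set (coord x) {..<d}"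
  by (simp add: norm_fsvec_def inner_Rd L2_set_def power2_eq_square)

lemma subspace_Rd: "subspace (Rd d)"
  by (simp add: Rd_def subspace_def)

text \<open>
  A function on \<open>R^d\<close> is a function on \<open>fsvec\<close> of which only the values on \<open>Rd d\<close> matter:
  derivatives are taken within \<open>Rd d\<close>, infima over \<open>Rd d\<close>.
\<close>

definition gradient :: "nat \<Rightarrow> (fsvec \<Rightarrow> real) \<Rightarrow> fsvec \<Rightarrow> fsvec" where
  "gradient d f x =
     (THE g. g \<in> Rd d \<and> (f has_derivative (\<lambda>h. inner g h)) (at x within Rd d))"

lift_definition unit_fsvec :: "nat \<Rightarrow> fsvec" is "\<lambda>i j. if j = i then 1 else 0"
  by simp

lemma coord_unit [simp]: "coord (unit_fsvec i) j = (if j = i then 1 else 0)"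
  by transfer simp

lemma unit_in_Rd: "i < d \<Longrightarrow> unit_fsvec i \<in> Rd d"
  by (simp add: Rd_def)

lemma coord_sum: "coord (\<Sum>i\<in>S. F i) j = (\<Sum>i\<in>S. coord (F i) j)"
  by (induction S rule: infinite_finite_induct) simp_all

lemma Rd_expansion:
  assumes "x \<in> Rd d"
  shows "x = (\<Sum>i<d. coord x i *\<^sub>R unit_fsvec i)"
  using assms by (intro fsvec_eqI) (auto simp: coord_sum Rd_def if_distrib[of "(*) _"] cong: if_cong)

lemma Rd_has_derivative_unique:
  assumes "(f has_derivative D) (at x within Rd d)" "(f has_derivative D') (at x within Rd d)"
    and "x \<in> Rd d" "h \<in> Rd d"
  shows "D h = D' h"
proof -
  let ?l = "\<lambda>t. x + t *\<^sub>R h"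
  have l: "(?l has_derivative (\<lambda>t. t *\<^sub>R h)) (at 0)"
    by (auto intro!: derivative_eq_intros)
  have sub: "range ?l \<subseteq> Rd d"
    using assms(3,4) by (auto simp: Rd_def)
  have *: "((\<lambda>t. f (?l t)) has_derivative (\<lambda>t. E (t *\<^sub>R h))) (at 0)"
    if "(f has_derivative E) (at x within Rd d)" for E
    using has_derivative_in_compose[OF l, of f E] has_derivative_subset[OF that sub] by simp
  have "(\<lambda>t. D (t *\<^sub>R h)) = (\<lambda>t. D' (t *\<^sub>R h))"
    using *[OF assms(1)] *[OF assms(2)] by (rule has_derivative_unique)
  from fun_cong[OF this, of 1] show ?thesis by simp
qed

lemma gradient_ex1:
  assumes "f differentiable (at x within Rd d)" "x \<in> Rd d"
  shows "\<exists>!g. g \<in> Rd d \<and> (f has_derivative (\<lambda>h. inner g h)) (at x within Rd d)"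
proof (rule ex_ex1I)
  obtain D where D: "(f has_derivative D) (at x within Rd d)"
    using assms(1) by (auto simp: differentiable_def)
  then interpret D: bounded_linear D by (rule has_derivative_bounded_linear)
  define g where "g = (\<Sum>i<d. D (unit_fsvec i) *\<^sub>R unit_fsvec i)"
  have g: "g \<in> Rd d"
    unfolding g_def by (intro subspace_sum subspace_scale subspace_Rd unit_in_Rd) simp
  have gD: "inner g h = D h" if h: "h \<in> Rd d" for h
  proof -
    have "inner g h = (\<Sum>i<d. coord h i * D (unit_fsvec i))"
      by (simp add: inner_Rd[OF g]) (auto simp: g_def coord_sum if_distrib[of "(*) _"] intro!: sum.cong cong: if_cong)
    also have "\<dots> = D (\<Sum>i<d. coord h i *\<^sub>R unit_fsvec i)"
      by (simp add: D.sum D.scaleR)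
    finally show ?thesis using Rd_expansion[OF h] by simp
  qed
  have "((\<lambda>y. (f y - f x - inner g (y - x)) /\<^sub>R norm (y - x)) \<longlongrightarrow> 0) (at x within Rd d)"
  proof (rule Lim_transform_within[OF _ zero_less_one])
    show "((\<lambda>y. (f y - f x - D (y - x)) /\<^sub>R norm (y - x)) \<longlongrightarrow> 0) (at x within Rd d)"
      using D by (simp add: has_derivative_at_within)
  qed (simp add: gD subspace_diff[OF subspace_Rd] assms(2))
  with g show "\<exists>g. g \<in> Rd d \<and> (f has_derivative (\<lambda>h. inner g h)) (at x within Rd d)"
    by (auto simp: has_derivative_at_within bounded_linear_inner_right)
next
  fix g g'
  assume "g \<in> Rd d \<and> (f has_derivative (\<lambda>h. inner g h)) (at x within Rd d)"
    and "g' \<in> Rd d \<and> (f has_derivative (\<lambda>h. inner g' h)) (at x within Rd d)"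
  then have "inner g (g - g') = inner g' (g - g')" and "g - g' \<in> Rd d"
    using Rd_has_derivative_unique[of f "inner g" x d "inner g'" "g - g'"] assms(2)
    by (auto simp: subspace_diff[OF subspace_Rd])
  then have "inner (g - g') (g - g') = 0" by (simp add: inner_diff_left)
  then show "g = g'" by simp
qed

definition inf_value :: "nat \<Rightarrow> (fsvec \<Rightarrow> real) \<Rightarrow> real" where
  "inf_value d f = (INF x\<in>Rd d. f x)"

definition sublevel0 :: "nat \<Rightarrow> (fsvec \<Rightarrow> real) \<Rightarrow> fsvec set" where
  "sublevel0 d f = {x \<in> Rd d. f x \<le> f 0}"

definition func_class :: "real \<Rightarrow> real \<Rightarrow> real \<Rightarrow> real \<Rightarrow> nat \<Rightarrow> (fsvec \<Rightarrow> real) set" where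
  "func_class \<alpha> L \<tau> \<Delta>\<^sub>0 d =
     {f. f differentiable_on Rd d \<and>
         bdd_below (f ` Rd d) \<and>
         f 0 - inf_value d f \<le> \<Delta>\<^sub>0 \<and>
         L-lipschitz_on (Rd d) (gradient d f) \<and>
         (\<forall>x\<in>sublevel0 d f. f x - inf_value d f \<le> \<tau> * norm (gradient d f x) powr \<alpha>)}"

text \<open>
  A method gives, for each dimension, a rule mapping the transcript (oldest entry first) to the next
  query. The start at the origin is its value on the empty transcript.
\<close>

type_synonym transcript = "(fsvec \<times> real \<times> fsvec) list"

definition first_order_method :: "(nat \<Rightarrow> transcript \<Rightarrow> fsvec) \<Rightarrow> bool" where
  "first_order_method A \<longleftrightarrow>
     (\<forall>d\<ge>1. A d [] = 0 \<and> (\<forall>tr\<in>lists (Rd d \<times> UNIV \<times> Rd d). A d tr \<in> Rd d))"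

primrec transcript_of ::
    "(nat \<Rightarrow> transcript \<Rightarrow> fsvec) \<Rightarrow> nat \<Rightarrow> (fsvec \<Rightarrow> real) \<Rightarrow> nat \<Rightarrow> transcript" where
  "transcript_of A d f 0 = []"
| "transcript_of A d f (Suc t) =
     (let tr = transcript_of A d f t; x = A d tr in tr @ [(x, f x, gradient d f x)])"

definition iterate ::
    "(nat \<Rightarrow> transcript \<Rightarrow> fsvec) \<Rightarrow> nat \<Rightarrow> (fsvec \<Rightarrow> real) \<Rightarrow> nat \<Rightarrow> fsvec" where
  "iterate A d f t = A d (transcript_of A d f t)"

text \<open>
  The suprema below may be infinite, hence \<open>ereal\<close>; the complexity is \<open>\<infinity>\<close> if no budget suffices,
  hence \<open>enat\<close>, where the infimum of the empty set is \<open>\<infinity>\<close>.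
\<close>

definition minimax_error :: "real \<Rightarrow> real \<Rightarrow> real \<Rightarrow> real \<Rightarrow> nat \<Rightarrow> ereal" where
  "minimax_error \<alpha> L \<tau> \<Delta>\<^sub>0 T =
     (INF A\<in>{A. first_order_method A}. SUP d\<in>{1..}. SUP f\<in>func_class \<alpha> L \<tau> \<Delta>\<^sub>0 d.
        ereal (f (iterate A d f T) - inf_value d f))"

definition oracle_complexity :: "real \<Rightarrow> real \<Rightarrow> real \<Rightarrow> real \<Rightarrow> real \<Rightarrow> enat" where
  "oracle_complexity \<alpha> L \<tau> \<Delta>\<^sub>0 \<epsilon> =
     (INF T\<in>{T. minimax_error \<alpha> L \<tau> \<Delta>\<^sub>0 T \<le> ereal \<epsilon>}. enat T)"

end

theory Submission
  imports Defs
begin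

text \<open>
  If \<open>|\<nabla>f|\<^sup>2 \<ge> \<mu> (f - f\<^sub>\<star>)\<close> and \<open>f(0) - f\<^sub>\<star> \<le> 4\<epsilon>\<close>, then \<open>f - f\<^sub>\<star> \<le> \<tau> |\<nabla>f|\<^sup>\<alpha>\<close> on the
  sublevel set as soon as \<open>\<mu>\<close> is of order \<open>\<tau>\<^bsup>-2/\<alpha>\<^esup> \<epsilon>\<^bsup>(2-\<alpha>)/\<alpha>\<^esup>\<close>. So it suffices to find a
  Polyak-Lojasiewicz function on which a constant fraction of the error survives of order
  \<open>L/\<mu>\<close> queries. With \<open>S\<close> a \<open>C\<^bsup>1,1\<^esup>\<close> smooth step from 0 to 1, take the chain
  \<open>\<Sum>\<^sub>i min(z\<^sub>i, 0)\<^sup>2/2 + 1 - S(z\<^sub>i\<^sub>-\<^sub>1) S((z\<^sub>i + 1)/2)\<close> with \<open>z\<^sub>-\<^sub>1 = 1\<close>. Every term decreases in every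
  variable, so the contributions to a partial derivative never cancel: the first link with
  \<open>z\<^sub>i < 3/4\<close> alone makes the gradient of order 1, and if there is none, the partial derivatives
  control the chain value directly. Since \<open>S\<close> and \<open>S'\<close> vanish at 0, the chain hides \<open>z\<^sub>i\<close> until
  \<open>z\<^sub>i\<^sub>-\<^sub>1\<close> has moved. The variables are put along orthogonal directions \<open>u\<^sub>t\<close> that a resisting oracle
  chooses orthogonal to the queries \<open>x\<^sub>0, ..., x\<^sub>t\<close>, so each query reveals at most one link.
\<close>

section \<open>The hard chain\<close>

text \<open>Away from 0 the function agrees locally with 0 or with a square; at 0 the difference
  quotient is at most |h|. Both \<open>penalty\<close> and \<open>step\<close> are combinations of
  shifts and reflections of this function.\<close>

lemma has_real_derivative_pos_part_sq:
  "((\<lambda>x. (max 0 x)\<^sup>2) has_real_derivative 2 * max 0 x) (at (x::real))"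
proof -
  consider "x < 0" | "x > 0" | "x = 0" by linarith
  then show ?thesis
  proof cases
    case 1
    have "((\<lambda>x. 0) has_real_derivative 2 * max 0 x) (at x)"
      using 1 by auto
    then show ?thesis
      by (rule has_field_derivative_transform_within_open[of _ _ _ "{..<0}"]) (use 1 in auto)
  next
    case 2
    have "((\<lambda>x. x\<^sup>2) has_real_derivative 2 * max 0 x) (at x)"
      using 2 by (auto intro!: derivative_eq_intros)
    then show ?thesis
      by (rule has_field_derivative_transform_within_open[of _ _ _ "{0<..}"]) (use 2 in auto)
  next
    case 3
    have "((\<lambda>h::real. (max 0 h)\<^sup>2 / h) \<longlongrightarrow> 0) (at 0)"
    proof (rule Lim_null_comparison)
      show "\<forall>\<^sub>F h in at 0. norm ((max 0 h)\<^sup>2 / h) \<le> \<bar>h\<bar>" for h :: real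
        by (intro always_eventually allI) (auto simp: max_def power2_eq_square)
      show "((\<lambda>h::real. \<bar>h\<bar>) \<longlongrightarrow> 0) (at 0)"
        by (auto intro!: tendsto_eq_intros)
    qed
    then show ?thesis
      unfolding 3 DERIV_def by simp
  qed
qed

definition penalty :: "real \<Rightarrow> real" where
  "penalty x = (min x 0)\<^sup>2 / 2"

lemma DERIV_penalty: "(penalty has_real_derivative min x 0) (at x)"
proof -
  have "((\<lambda>x. (max 0 (- x))\<^sup>2 / 2) has_real_derivative (2 * max 0 (- x)) * (-1) / 2) (at x)"
    by (intro DERIV_cdivide DERIV_chain2[OF has_real_derivative_pos_part_sq]) (auto intro!: derivative_eq_intros)
  moreover have "penalty = (\<lambda>x. (max 0 (- x))\<^sup>2 / 2)"
    by (auto simp: penalty_def fun_eq_iff min_def max_def)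
  moreover have "(2 * max 0 (- x)) * (-1) / 2 = min x 0" by (auto simp: min_def max_def)
  ultimately show ?thesis by simp
qed

text \<open>A quadratic spline written in truncated powers: \<open>2 * x\<^sup>2\<close> on
  [0, 1/2], \<open>1 - 2 * (1 - x)\<^sup>2\<close> on [1/2, 1], constant outside. In this form one
  derivative rule covers all pieces.\<close>

definition step :: "real \<Rightarrow> real" where
  "step x = 2 * (max 0 x)\<^sup>2 - 4 * (max 0 (x - 1/2))\<^sup>2 + 2 * (max 0 (x - 1))\<^sup>2"

text \<open>A hat of height 2 and slope 4; these numbers become the Lipschitz constants of
  \<open>step\<close> and of its derivative.\<close>

definition step_deriv :: "real \<Rightarrow> real" where
  "step_deriv x = 4 * max 0 (min x (1 - x))"

lemma DERIV_step: "(step has_real_derivative step_deriv x) (at x)"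
proof -
  have *: "((\<lambda>x. (max 0 (x - a))\<^sup>2) has_real_derivative (2 * max 0 (x - a)) * 1) (at x)" for a :: real
    by (intro DERIV_chain2[OF has_real_derivative_pos_part_sq]) (auto intro!: derivative_eq_intros)
  have "step_deriv x = 2 * (2 * max 0 x) - 4 * (2 * max 0 (x - 1/2) * 1) + 2 * (2 * max 0 (x - 1) * 1)"
    by (auto simp: step_deriv_def min_def max_def)
  then show ?thesis
    unfolding step_def[abs_def]
    by (auto intro!: DERIV_add DERIV_diff DERIV_cmult has_real_derivative_pos_part_sq * simp only:)
qed

lemma step_deriv_bounds: "0 \<le> step_deriv x" "step_deriv x \<le> 2"
  by (auto simp: step_deriv_def min_def max_def)

lemma step_deriv_lipschitz: "\<bar>step_deriv x - step_deriv y\<bar> \<le> 4 * \<bar>x - y\<bar>"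
  by (auto simp: step_deriv_def min_def max_def abs_if)

lemma step_lipschitz: "\<bar>step x - step y\<bar> \<le> 2 * \<bar>x - y\<bar>"
  using field_differentiable_bound[of UNIV step step_deriv 2 x y] DERIV_step step_deriv_bounds
  by (auto simp: has_field_derivative_at_within abs_le_iff)

lemma step_nonpos [simp]: "x \<le> 0 \<Longrightarrow> step x = 0" "x \<le> 0 \<Longrightarrow> step_deriv x = 0"
  by (auto simp: step_def step_deriv_def)

lemma step_upper: "1/2 \<le> x \<Longrightarrow> step x = 1 - 2 * (max 0 (1 - x))\<^sup>2"
  by (auto simp: step_def max_def power2_eq_square algebra_simps)

lemma step_mono: "x \<le> y \<Longrightarrow> step x \<le> step y"
  using DERIV_nonneg_imp_nondecreasing[of x y step] DERIV_step step_deriv_bounds by blast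

lemma step_nonneg: "0 \<le> step x"
  using step_mono[of "min x 0" x] by simp

lemma step_le_1: "step x \<le> 1"
  using step_mono[of x "max x 1"] step_upper[of "max x 1"] by simp

section \<open>The chain and its derivative\<close>

definition prev :: "(nat \<Rightarrow> real) \<Rightarrow> nat \<Rightarrow> real" where
  "prev z i = (if i = 0 then 1 else z (i - 1))"

text \<open>The factor in \<open>z i\<close> is shifted to have maximal slope at
  \<open>z i = 0\<close>, where \<open>step\<close> itself is flat: an unmoved variable feels its
  own link but keeps the next one switched off. For \<open>z i \<le> -1\<close> the shifted factor
  is flat and the penalty supplies the slope.\<close>

definition chain :: "nat \<Rightarrow> (nat \<Rightarrow> real) \<Rightarrow> real" where
  "chain N z = (\<Sum>i<N. penalty (z i) + (1 - step (prev z i) * step ((z i + 1) / 2)))"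

text \<open>The last term comes from link \<open>j + 1\<close>, which the last variable does not
  have. All three contributions are nonpositive.\<close>

definition chain_partial :: "nat \<Rightarrow> (nat \<Rightarrow> real) \<Rightarrow> nat \<Rightarrow> real" where
  "chain_partial N z j = min (z j) 0 - step (prev z j) * (step_deriv ((z j + 1) / 2) / 2)
     - (if Suc j < N then step_deriv (z j) * step ((z (Suc j) + 1) / 2) else 0)"

text \<open>Link \<open>i\<close> also depends on variable \<open>i - 1\<close>; this reindexing
  charges that contribution to the variable instead of the link.\<close>

lemma sum_lessThan_pred:
  fixes g :: "nat \<Rightarrow> 'a::comm_monoid_add"
  shows "(\<Sum>i<N. if i = 0 then 0 else g i) = (\<Sum>j<N. if Suc j < N then g (Suc j) else 0)"
proof (cases N)
  case (Suc M)
  have "(\<Sum>i<N. if i = 0 then 0 else g i) = (\<Sum>j<M. g (Suc j))"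
    unfolding Suc by (subst sum.lessThan_Suc_shift) simp
  also have "\<dots> = (\<Sum>j<N. if Suc j < N then g (Suc j) else 0)"
    unfolding Suc by simp
  finally show ?thesis .
qed simp

text \<open>The \<open>u i\<close> are arbitrary vectors, so the formula also applies while some
  directions are still zero.\<close>

lemma chain_has_derivative:
  fixes u :: "nat \<Rightarrow> 'a::real_inner"
  shows "((\<lambda>x. chain N (\<lambda>i. inner (u i) x)) has_derivative
     (\<lambda>h. \<Sum>j<N. chain_partial N (\<lambda>i. inner (u i) x) j * inner (u j) h)) (at x within X)"
proof -
  define z where "z = (\<lambda>x i. inner (u i) x)"
  have z: "((\<lambda>x. z x i) has_derivative (\<lambda>h. z h i)) (at x within X)" for i
    unfolding z_def by (auto intro!: derivative_eq_intros)
  have p: "((\<lambda>x. prev (z x) i) has_derivative (\<lambda>h. if i = 0 then 0 else z h (i - 1))) (at x within X)" for i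
    by (cases i) (auto simp: prev_def z)
  have q: "((\<lambda>x. (z x i + 1) / 2) has_derivative (\<lambda>h. z h i / 2)) (at x within X)" for i
    by (auto intro!: derivative_eq_intros z)
  have penalty_o: "((\<lambda>x. penalty (g x)) has_derivative (\<lambda>h. min (g x) 0 * g' h)) (at x within X)"
    and step_o: "((\<lambda>x. step (g x)) has_derivative (\<lambda>h. step_deriv (g x) * g' h)) (at x within X)"
    if "(g has_derivative g') (at x within X)" for g g'
    using DERIV_compose_FDERIV[OF DERIV_penalty that] DERIV_compose_FDERIV[OF DERIV_step that]
    by (simp_all add: mult.commute)
  have D: "((\<lambda>x. chain N (z x)) has_derivative
     (\<lambda>h. \<Sum>i<N. min (z x i) 0 * z h i
        + (0 - (step (prev (z x) i) * (step_deriv ((z x i + 1) / 2) * (z h i / 2))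
             + (step_deriv (prev (z x) i) * (if i = 0 then 0 else z h (i - 1))) * step ((z x i + 1) / 2)))))
     (at x within X)"
    unfolding chain_def
    by (intro has_derivative_sum has_derivative_add has_derivative_diff has_derivative_const
        has_derivative_mult penalty_o step_o p q z)
  have "(\<lambda>h. \<Sum>i<N. min (z x i) 0 * z h i
        + (0 - (step (prev (z x) i) * (step_deriv ((z x i + 1) / 2) * (z h i / 2))
             + (step_deriv (prev (z x) i) * (if i = 0 then 0 else z h (i - 1))) * step ((z x i + 1) / 2))))
     = (\<lambda>h. \<Sum>j<N. chain_partial N (z x) j * z h j)"
  proof
    fix h
    have "(\<Sum>i<N. (step_deriv (prev (z x) i) * (if i = 0 then 0 else z h (i - 1))) * step ((z x i + 1) / 2))
       = (\<Sum>i<N. if i = 0 then 0 else step_deriv (z x (i - 1)) * z h (i - 1) * step ((z x i + 1) / 2))"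
      by (intro sum.cong) (auto simp: prev_def)
    also have "\<dots> = (\<Sum>j<N. if Suc j < N then step_deriv (z x j) * z h j * step ((z x (Suc j) + 1) / 2) else 0)"
      by (subst sum_lessThan_pred) (simp cong: if_cong)
    finally have *: "(\<Sum>i<N. (step_deriv (prev (z x) i) * (if i = 0 then 0 else z h (i - 1))) * step ((z x i + 1) / 2))
       = \<dots>" .
    show "(\<Sum>i<N. min (z x i) 0 * z h i
        + (0 - (step (prev (z x) i) * (step_deriv ((z x i + 1) / 2) * (z h i / 2))
             + (step_deriv (prev (z x) i) * (if i = 0 then 0 else z h (i - 1))) * step ((z x i + 1) / 2))))
        = (\<Sum>j<N. chain_partial N (z x) j * z h j)"
      \<comment> \<open>The sums are split so that the predecessor part can be reindexed, then
        merged again and compared term by term.\<close>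
      unfolding sum.distrib sum_subtractf * unfolding sum.distrib[symmetric] sum_subtractf[symmetric]
      by (intro sum.cong) (auto simp: chain_partial_def algebra_simps)
  qed
  with D show ?thesis by (simp add: z_def)
qed

section \<open>Values of the chain\<close>

lemma chain_nonneg: "0 \<le> chain N z"
  unfolding chain_def
  by (intro sum_nonneg add_nonneg_nonneg) (auto simp: penalty_def step_nonneg step_le_1 mult_le_one)

lemma chain_0_le: "chain N (\<lambda>_. 0) \<le> N"
proof -
  have "chain N (\<lambda>_. 0) \<le> (\<Sum>i<N. 1)"
    unfolding chain_def by (intro sum_mono) (auto simp: penalty_def step_nonneg)
  then show ?thesis by simp
qed

lemma chain_1: "chain N (\<lambda>_. 1) = 0"
  by (simp add: chain_def penalty_def prev_def step_upper)

lemma chain_cong: "(\<And>i. i < N \<Longrightarrow> z i = z' i) \<Longrightarrow> chain N z = chain N z'"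
  unfolding chain_def by (intro sum.cong) (auto simp: prev_def)

text \<open>Each link \<open>i > t\<close> has predecessor 0, where \<open>step\<close> vanishes, so
  it costs at least 1. Link \<open>t\<close> is left out because its predecessor may have
  moved.\<close>

lemma chain_ge_zero_tail:
  assumes "\<And>i. i \<ge> t \<Longrightarrow> z i = 0" "t < N"
  shows "real N - real t - 1 \<le> chain N z"
proof -
  have "real N - real t - 1 = (\<Sum>i\<in>{Suc t..<N}. 1)"
    using assms(2) by (simp add: of_nat_diff)
  also have "\<dots> \<le> (\<Sum>i\<in>{Suc t..<N}. penalty (z i) + (1 - step (prev z i) * step ((z i + 1) / 2)))"
    by (intro sum_mono) (auto simp: prev_def assms penalty_def)
  also have "\<dots> \<le> chain N z"
    unfolding chain_def
    by (intro sum_mono2 add_nonneg_nonneg) (auto simp: penalty_def step_nonneg step_le_1 mult_le_one)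
  finally show ?thesis .
qed

text \<open>The zero-chain property: for \<open>j > t\<close> both \<open>z j\<close> and its
  predecessor are 0, where \<open>step\<close> and \<open>step_deriv\<close> vanish. At
  \<open>j = t\<close> the predecessor may be nonzero, so one new index can appear.\<close>

lemma chain_partial_zero_tail:
  assumes "\<And>i. i \<ge> t \<Longrightarrow> z i = 0" "t < j"
  shows "chain_partial N z j = 0"
  using assms by (simp add: chain_partial_def prev_def)

section \<open>Lipschitz continuity of the chain gradient\<close>

lemma mult_diff_bound:
  fixes a b a' b' :: real
  assumes "\<bar>a\<bar> \<le> A" "\<bar>b'\<bar> \<le> B"
  shows "\<bar>a * b - a' * b'\<bar> \<le> A * \<bar>b - b'\<bar> + B * \<bar>a - a'\<bar>"
proof -
  have "\<bar>a * b - a' * b'\<bar> = \<bar>a * (b - b') + (a - a') * b'\<bar>" by (simp add: algebra_simps)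
  also have "\<dots> \<le> \<bar>a\<bar> * \<bar>b - b'\<bar> + \<bar>b'\<bar> * \<bar>a - a'\<bar>"
    by (metis abs_mult abs_triangle_ineq mult.commute)
  also have "\<dots> \<le> A * \<bar>b - b'\<bar> + B * \<bar>a - a'\<bar>"
    using assms by (intro add_mono mult_right_mono) auto
  finally show ?thesis .
qed

text \<open>Each partial derivative depends only on a variable and its two neighbours, so the
  gradient is 10-Lipschitz in the Euclidean norm, independently of \<open>N\<close>.\<close>

lemma chain_partial_lipschitz:
  "(\<Sum>j<N. (chain_partial N z j - chain_partial N z' j)\<^sup>2) \<le> 100 * (\<Sum>j<N. (z j - z' j)\<^sup>2)"
proof -
  define \<delta> where "\<delta> j = \<bar>z j - z' j\<bar>" for j
  define \<delta>p where "\<delta>p j = (if j = 0 then 0 else \<delta> (j - 1))" for j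
  define \<delta>n where "\<delta>n j = (if Suc j < N then \<delta> (Suc j) else 0)" for j
  \<comment> \<open>The coefficient 6 is 1 from the penalty, 1 from the variable's own link and 4
    from the next link.\<close>
  have bd: "\<bar>chain_partial N z j - chain_partial N z' j\<bar> \<le> 2 * \<delta>p j + 6 * \<delta> j + 2 * \<delta>n j" for j
  proof -
    have a: "\<bar>min (z j) 0 - min (z' j) 0\<bar> \<le> \<delta> j"
      by (auto simp: \<delta>_def min_def)
    have "\<bar>step (prev z j) * (step_deriv ((z j + 1) / 2) / 2) - step (prev z' j) * (step_deriv ((z' j + 1) / 2) / 2)\<bar>
       \<le> 1 * \<bar>step_deriv ((z j + 1) / 2) / 2 - step_deriv ((z' j + 1) / 2) / 2\<bar>
         + 1 * \<bar>step (prev z j) - step (prev z' j)\<bar>"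
      using step_nonneg step_le_1 step_deriv_bounds
      by (intro mult_diff_bound) (auto simp: abs_le_iff intro: order_trans[of _ 0])
    also have "\<bar>step_deriv ((z j + 1) / 2) / 2 - step_deriv ((z' j + 1) / 2) / 2\<bar> \<le> \<delta> j"
      using step_deriv_lipschitz[of "(z j + 1) / 2" "(z' j + 1) / 2"] by (simp add: \<delta>_def diff_divide_distrib[symmetric])
    also have "\<bar>step (prev z j) - step (prev z' j)\<bar> \<le> 2 * \<delta>p j"
      using step_lipschitz[of "prev z j" "prev z' j"] by (auto simp: \<delta>_def \<delta>p_def prev_def)
    finally have b: "\<bar>step (prev z j) * (step_deriv ((z j + 1) / 2) / 2) - step (prev z' j) * (step_deriv ((z' j + 1) / 2) / 2)\<bar>
       \<le> \<delta> j + 2 * \<delta>p j" by simp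
    let ?s = "\<lambda>z. if Suc j < N then step_deriv (z j) * step ((z (Suc j) + 1) / 2) else 0"
    have c: "\<bar>?s z - ?s z'\<bar> \<le> 4 * \<delta> j + 2 * \<delta>n j"
    proof (cases "Suc j < N")
      case True
      have "\<bar>step_deriv (z j) * step ((z (Suc j) + 1) / 2) - step_deriv (z' j) * step ((z' (Suc j) + 1) / 2)\<bar>
         \<le> 2 * \<bar>step ((z (Suc j) + 1) / 2) - step ((z' (Suc j) + 1) / 2)\<bar> + 1 * \<bar>step_deriv (z j) - step_deriv (z' j)\<bar>"
        using step_nonneg step_le_1 step_deriv_bounds by (intro mult_diff_bound) (auto simp: abs_le_iff intro: order_trans[of _ 0])
      moreover have "\<bar>step ((z (Suc j) + 1) / 2) - step ((z' (Suc j) + 1) / 2)\<bar> \<le> \<delta>n j"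
        using step_lipschitz[of "(z (Suc j) + 1) / 2" "(z' (Suc j) + 1) / 2"] True
        by (simp add: \<delta>_def \<delta>n_def diff_divide_distrib[symmetric])
      ultimately show ?thesis using step_deriv_lipschitz[of "z j" "z' j"] True by (simp add: \<delta>_def)
    qed (simp add: \<delta>_def \<delta>n_def)
    show ?thesis using a b c unfolding chain_partial_def by linarith
  qed
  have sq: "(chain_partial N z j - chain_partial N z' j)\<^sup>2
      \<le> 20 * (\<delta>p j)\<^sup>2 + 60 * (\<delta> j)\<^sup>2 + 20 * (\<delta>n j)\<^sup>2" for j
  proof -
    have "(chain_partial N z j - chain_partial N z' j)\<^sup>2 \<le> (2 * \<delta>p j + 6 * \<delta> j + 2 * \<delta>n j)\<^sup>2"
      using bd[of j] by (metis abs_ge_zero power2_abs power_mono)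
    \<comment> \<open>Cauchy-Schwarz with weights 2, 6, 2 as an explicit identity; the factor 10 is
      their sum.\<close>
    also have "\<dots> = 20 * (\<delta>p j)\<^sup>2 + 60 * (\<delta> j)\<^sup>2 + 20 * (\<delta>n j)\<^sup>2
        - 12 * (\<delta>p j - \<delta> j)\<^sup>2 - 4 * (\<delta>p j - \<delta>n j)\<^sup>2 - 12 * (\<delta> j - \<delta>n j)\<^sup>2"
      by (simp add: power2_eq_square algebra_simps)
    finally show ?thesis
      using zero_le_power2[of "\<delta>p j - \<delta> j"] zero_le_power2[of "\<delta>p j - \<delta>n j"] zero_le_power2[of "\<delta> j - \<delta>n j"]
      by linarith
  qed
  \<comment> \<open>Shifting the index in either direction does not increase the sum of squares, so
    the total constant is 20 + 60 + 20.\<close>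
  have "(\<Sum>j<N. (\<delta>p j)\<^sup>2) = (\<Sum>i<N. if i = 0 then 0 else (\<delta> (i - 1))\<^sup>2)"
    by (intro sum.cong) (auto simp: \<delta>p_def)
  also have "\<dots> = (\<Sum>j<N. if Suc j < N then (\<delta> j)\<^sup>2 else 0)"
    by (subst sum_lessThan_pred) (simp cong: if_cong)
  also have "\<dots> \<le> (\<Sum>j<N. (\<delta> j)\<^sup>2)"
    by (intro sum_mono) auto
  finally have p: "(\<Sum>j<N. (\<delta>p j)\<^sup>2) \<le> (\<Sum>j<N. (\<delta> j)\<^sup>2)" .
  have "(\<Sum>j<N. (\<delta>n j)\<^sup>2) = (\<Sum>j<N. if Suc j < N then (\<delta> (Suc j))\<^sup>2 else 0)"
    by (intro sum.cong) (auto simp: \<delta>n_def)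
  also have "\<dots> = (\<Sum>i<N. if i = 0 then 0 else (\<delta> i)\<^sup>2)"
    by (subst sum_lessThan_pred) simp
  also have "\<dots> \<le> (\<Sum>j<N. (\<delta> j)\<^sup>2)"
    by (intro sum_mono) auto
  finally have n: "(\<Sum>j<N. (\<delta>n j)\<^sup>2) \<le> (\<Sum>j<N. (\<delta> j)\<^sup>2)" .
  have "(\<Sum>j<N. (chain_partial N z j - chain_partial N z' j)\<^sup>2)
      \<le> (\<Sum>j<N. 20 * (\<delta>p j)\<^sup>2 + 60 * (\<delta> j)\<^sup>2 + 20 * (\<delta>n j)\<^sup>2)"
    by (intro sum_mono sq)
  also have "\<dots> = 20 * (\<Sum>j<N. (\<delta>p j)\<^sup>2) + 60 * (\<Sum>j<N. (\<delta> j)\<^sup>2) + 20 * (\<Sum>j<N. (\<delta>n j)\<^sup>2)"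
    by (simp add: sum.distrib sum_distrib_left)
  also have "\<dots> \<le> 100 * (\<Sum>j<N. (\<delta> j)\<^sup>2)" using p n by linarith
  finally show ?thesis by (simp add: \<delta>_def)
qed

section \<open>Polyak-Lojasiewicz inequality for the chain\<close>

lemma chain_partial_ge:
  shows "step (prev z j) * (step_deriv ((z j + 1) / 2) / 2) - min (z j) 0 \<le> \<bar>chain_partial N z j\<bar>"
proof -
  \<comment> \<open>As the three contributions share their sign, dropping the one from the next link
    only decreases the absolute value.\<close>
  have "0 \<le> (if Suc j < N then step_deriv (z j) * step ((z (Suc j) + 1) / 2) else 0)"
    by (simp add: step_deriv_bounds step_nonneg)
  then show ?thesis unfolding chain_partial_def by linarith
qed

lemma chain_le_partials:
  "chain N z \<le> 26 * real N * (\<Sum>j<N. (chain_partial N z j)\<^sup>2)"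
proof (cases "\<exists>k<N. z k < 3/4")
  case True
  \<comment> \<open>Minimality of \<open>k\<close> forces its predecessor to be at least 3/4, so
    link \<open>k\<close> is switched on to at least \<open>step (3/4) = 7/8\<close>.\<close>
  define k where "k = (LEAST k. k < N \<and> z k < 3/4)"
  define g where "g = (\<Sum>j<N. (chain_partial N z j)\<^sup>2)"
  have k: "k < N" "z k < 3/4"
    using LeastI_ex[OF True] by (auto simp: k_def)
  have "3/4 \<le> prev z k"
    using k not_less_Least[of "k - 1" "\<lambda>k. k < N \<and> z k < 3/4"] by (auto simp: prev_def k_def)
  then have s: "7/8 \<le> step (prev z k)"
    using step_mono[of "3/4" "prev z k"] step_upper[of "3/4"] by (simp add: power2_eq_square)
  have "1/5 \<le> \<bar>chain_partial N z k\<bar>"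
  \<comment> \<open>Below -1/2 the penalty slope exceeds 1/2. Otherwise the argument of the second
    factor lies in [1/4, 7/8), where half its slope is at least 1/4, and 7/32 exceeds 1/5.\<close>
  proof (cases "z k < -1/2")
    case True
    have "0 \<le> step (prev z k) * (step_deriv ((z k + 1) / 2) / 2)"
      by (simp add: step_deriv_bounds step_nonneg)
    then show ?thesis using chain_partial_ge[of z k N] True by simp
  next
    case False
    have "1/4 \<le> step_deriv ((z k + 1) / 2) / 2"
      using k False by (auto simp: step_deriv_def min_def max_def)
    then have "7/8 * (1/4) \<le> step (prev z k) * (step_deriv ((z k + 1) / 2) / 2)"
      using s by (intro mult_mono) auto
    then show ?thesis using chain_partial_ge[of z k N] by linarith
  qed
  then have "(1/5)\<^sup>2 \<le> (chain_partial N z k)\<^sup>2"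
    by (metis abs_ge_zero power2_abs power_mono zero_le_divide_1_iff zero_le_numeral)
  also have "\<dots> \<le> g"
    unfolding g_def using k by (intro member_le_sum) auto
  finally have g1: "1/25 \<le> g" by (simp add: power2_eq_square)
  \<comment> \<open>The penalties can be unbounded, so the lower bound 1/25 on \<open>g\<close>
    alone is not enough; they are absorbed by the partial derivatives themselves.\<close>
  have g2: "(\<Sum>j<N. (min (z j) 0)\<^sup>2) \<le> g"
    unfolding g_def
  proof (intro sum_mono)
    fix j
    have "0 \<le> step (prev z j) * (step_deriv ((z j + 1) / 2) / 2)"
      by (simp add: step_deriv_bounds step_nonneg)
    then have "\<bar>min (z j) 0\<bar> \<le> \<bar>chain_partial N z j\<bar>"
      using chain_partial_ge[of z j N] by linarith
    then show "(min (z j) 0)\<^sup>2 \<le> (chain_partial N z j)\<^sup>2"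
      by (simp only: abs_le_square_iff)
  qed
  have "chain N z \<le> (\<Sum>j<N. (min (z j) 0)\<^sup>2 / 2 + 1)"
    unfolding chain_def penalty_def by (intro sum_mono) (simp add: step_nonneg)
  also have "\<dots> = (\<Sum>j<N. (min (z j) 0)\<^sup>2) / 2 + real N"
    by (simp add: sum.distrib sum_divide_distrib)
  also have "\<dots> \<le> g + real N"
    using g2 g1 by simp
  also have "\<dots> \<le> real N * g + real N * (25 * g)"
    using g1 k by (intro add_mono) (auto simp: mult_le_cancel_left1 mult_le_cancel_right1)
  finally show ?thesis by (simp add: g_def)
next
  case False
  then have z: "3/4 \<le> z j" if "j < N" for j using that by force
  \<comment> \<open>The distance of \<open>z j\<close> below the minimising value 1. Past 3/4 the
    chain and the squared partial derivatives are both controlled by the squares of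
    \<open>a\<close>.\<close>
  define a where "a j = max 0 (1 - z j)" for j
  have a: "(a j)\<^sup>2 \<le> 2 * (chain_partial N z j)\<^sup>2" if "j < N" for j
  proof -
    have "3/4 \<le> prev z j" using z that by (auto simp: prev_def)
    then have s: "7/8 \<le> step (prev z j)"
      using step_mono[of "3/4" "prev z j"] step_upper[of "3/4"] by (simp add: power2_eq_square)
    have "step_deriv ((z j + 1) / 2) / 2 = a j"
      using z[OF that] by (auto simp: step_deriv_def a_def min_def max_def field_simps)
    moreover have "7/8 * a j \<le> step (prev z j) * a j"
      using s by (intro mult_right_mono) (auto simp: a_def)
    ultimately have "7/8 * a j \<le> \<bar>chain_partial N z j\<bar>"
      using chain_partial_ge[of z j N] by simp
    then have "(7/8 * a j)\<^sup>2 \<le> (chain_partial N z j)\<^sup>2"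
      using power_mono[of "7/8 * a j" "\<bar>chain_partial N z j\<bar>" 2] by (simp add: a_def)
    moreover have "(7/8 * a j)\<^sup>2 = 49/64 * (a j)\<^sup>2" by (simp add: power2_eq_square)
    ultimately show ?thesis using zero_le_power2[of "a j"] zero_le_power2[of "chain_partial N z j"] by linarith
  qed
  have "chain N z \<le> (\<Sum>i<N. (if i = 0 then 0 else 2 * (a (i - 1))\<^sup>2) + (a i)\<^sup>2 / 2)"
    unfolding chain_def
  proof (intro sum_mono)
    fix i assume "i \<in> {..<N}"
    then have i: "3/4 \<le> z i" and i': "3/4 \<le> prev z i" using z by (auto simp: prev_def)
    \<comment> \<open>Expanding this product decouples the two factors of a link.\<close>
    have "0 \<le> (1 - step (prev z i)) * (1 - step ((z i + 1) / 2))"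
      by (simp add: step_le_1)
    then have "1 - step (prev z i) * step ((z i + 1) / 2) \<le> (1 - step (prev z i)) + (1 - step ((z i + 1) / 2))"
      by (simp add: algebra_simps)
    moreover have "1 - step (prev z i) = (if i = 0 then 0 else 2 * (a (i - 1))\<^sup>2)"
      using i' by (subst step_upper) (auto simp: a_def prev_def)
    moreover have "1 - step ((z i + 1) / 2) = (a i)\<^sup>2 / 2"
      using i by (subst step_upper) (auto simp: a_def max_def power2_eq_square field_simps)
    moreover have "penalty (z i) = 0" using i by (simp add: penalty_def)
    ultimately show "penalty (z i) + (1 - step (prev z i) * step ((z i + 1) / 2))
       \<le> (if i = 0 then 0 else 2 * (a (i - 1))\<^sup>2) + (a i)\<^sup>2 / 2"
      by linarith
  qed
  also have "\<dots> = (\<Sum>j<N. if Suc j < N then 2 * (a j)\<^sup>2 else 0) + (\<Sum>j<N. (a j)\<^sup>2 / 2)"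
    by (simp add: sum.distrib sum_lessThan_pred cong: if_cong)
  also have "\<dots> \<le> (\<Sum>j<N. 2 * (a j)\<^sup>2) + (\<Sum>j<N. (a j)\<^sup>2 / 2)"
    by (intro add_mono sum_mono) auto
  also have "\<dots> = (\<Sum>j<N. 5/2 * (a j)\<^sup>2)"
    by (simp add: sum.distrib[symmetric] algebra_simps)
  also have "\<dots> \<le> (\<Sum>j<N. 5 * (chain_partial N z j)\<^sup>2)"
    using a by (intro sum_mono) force
  also have "\<dots> \<le> (\<Sum>j<N. 26 * real N * (chain_partial N z j)\<^sup>2)"
  proof (intro sum_mono mult_right_mono)
    fix j assume "j \<in> {..<N}"
    then have "1 \<le> N" by auto
    then have "1 \<le> real N" by simp
    then show "5 \<le> 26 * real N" by linarith
  qed simp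
  finally show ?thesis by (simp add: sum_distrib_left)
qed

section \<open>Orthogonal families\<close>

text \<open>The norm is prescribed only below \<open>N\<close>, since the families of directions in
  use vanish from \<open>N\<close> on.\<close>

lemma inner_sum_orthogonal:
  fixes u :: "nat \<Rightarrow> 'a::real_inner"
  assumes "\<And>i j. i \<noteq> j \<Longrightarrow> inner (u i) (u j) = 0" "\<And>i. i < N \<Longrightarrow> norm (u i) = \<rho>" "k < N"
  shows "inner (u k) (\<Sum>j<N. a j *\<^sub>R u j) = \<rho>\<^sup>2 * a k"
proof -
  have "inner (u k) (\<Sum>j<N. a j *\<^sub>R u j) = (\<Sum>j<N. if j = k then \<rho>\<^sup>2 * a k else 0)"
    unfolding inner_sum_right using assms
    by (intro sum.cong) (auto simp: power2_norm_eq_inner[symmetric] mult.commute)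
  then show ?thesis using assms(3) by simp
qed

lemma norm_sum_orthogonal:
  fixes u :: "nat \<Rightarrow> 'a::real_inner"
  assumes "\<And>i j. i \<noteq> j \<Longrightarrow> inner (u i) (u j) = 0" "\<And>i. i < N \<Longrightarrow> norm (u i) = \<rho>"
  shows "(norm (\<Sum>j<N. a j *\<^sub>R u j))\<^sup>2 = \<rho>\<^sup>2 * (\<Sum>j<N. (a j)\<^sup>2)"
  unfolding power2_norm_eq_inner
  by (subst (1) inner_sum_left)
    (simp add: inner_sum_orthogonal[of u N \<rho>] assms sum_distrib_left power2_eq_square algebra_simps)

lemma bessel_orthogonal:
  fixes u :: "nat \<Rightarrow> 'a::real_inner"
  assumes "\<And>i j. i \<noteq> j \<Longrightarrow> inner (u i) (u j) = 0" "\<And>i. i < N \<Longrightarrow> norm (u i) = \<rho>" "0 < \<rho>"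
  shows "(\<Sum>j<N. (inner (u j) x)\<^sup>2) \<le> \<rho>\<^sup>2 * (norm x)\<^sup>2"
proof -
  define c where "c j = inner (u j) x" for j
  define y where "y = (\<Sum>j<N. c j *\<^sub>R u j)"
  have xy: "inner x y = (\<Sum>j<N. (c j)\<^sup>2)"
    by (simp add: y_def inner_sum_right c_def inner_commute power2_eq_square)
  have yy: "(norm y)\<^sup>2 = \<rho>\<^sup>2 * (\<Sum>j<N. (c j)\<^sup>2)"
    unfolding y_def by (rule norm_sum_orthogonal[OF assms(1,2)])
  \<comment> \<open>\<open>y\<close> is \<open>\<rho>\<^sup>2\<close> times the orthogonal
    projection of \<open>x\<close> onto the span of the family.\<close>
  have "0 \<le> (norm (\<rho>\<^sup>2 *\<^sub>R x - y))\<^sup>2" by simp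
  also have "\<dots> = \<rho>\<^sup>2 * (\<rho>\<^sup>2 * (norm x)\<^sup>2) - 2 * \<rho>\<^sup>2 * inner x y + (norm y)\<^sup>2"
    by (simp add: power2_norm_eq_inner inner_diff_left inner_diff_right inner_commute algebra_simps)
  also have "\<dots> = \<rho>\<^sup>2 * (\<rho>\<^sup>2 * (norm x)\<^sup>2 - (\<Sum>j<N. (c j)\<^sup>2))"
    unfolding xy yy by (simp add: algebra_simps)
  finally show ?thesis using assms(3) by (simp add: zero_le_mult_iff c_def)
qed

text \<open>Fewer than \<open>d\<close> vectors cannot span all unit vectors; a missed one, minus
  its projection onto the span, can be rescaled to any length.\<close>

lemma Rd_orthogonal_exists:
  assumes "finite S" "card S < d" "S \<subseteq> Rd d" "0 \<le> \<rho>"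
  shows "\<exists>v\<in>Rd d. norm v = \<rho> \<and> (\<forall>x\<in>S. inner v x = 0)"
proof -
  let ?E = "unit_fsvec ` {..<d}"
  obtain C where C: "finite C" "card C \<le> card S" "span C = span S" "pairwise orthogonal C"
    using basis_orthogonal[OF assms(1)] by blast
  have unit: "inner (unit_fsvec i) x = coord x i" for i x
    by (subst inner_fsvec_superset[of "{i}"]) (auto split: if_splits)
  have inj: "inj_on unit_fsvec {..<d}"
    by (rule inj_onI) (metis coord_unit zero_neq_one)
  have "pairwise orthogonal ?E"
    by (auto simp: pairwise_def orthogonal_def unit)
  moreover have "0 \<notin> ?E"
    using coord_unit by (metis coord_simps(1) imageE zero_neq_one)
  ultimately have "independent ?E" by (rule pairwise_orthogonal_independent)
  with independent_span_bound[OF C(1), of ?E] C(2) assms(2)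
  have "\<not> ?E \<subseteq> span C" by (auto simp: card_image[OF inj])
  then obtain i where i: "i < d" "unit_fsvec i \<notin> span C" by auto
  define e where "e = unit_fsvec i"
  \<comment> \<open>The Gram-Schmidt residual. If \<open>C\<close> contains 0, division by zero
    gives the coefficient 0 and its summand vanishes.\<close>
  define w where "w = e - (\<Sum>b\<in>C. (inner b e / inner b b) *\<^sub>R b)"
  have sub: "C \<subseteq> Rd d"
    using C(3) span_superset[of C] span_minimal[OF assms(3) subspace_Rd] by simp
  have wd: "w \<in> Rd d"
    unfolding w_def e_def using sub i
    by (intro subspace_diff subspace_sum subspace_scale subspace_Rd unit_in_Rd) auto
  have w0: "w \<noteq> 0"
  proof
    assume "w = 0"
    then have "e = (\<Sum>b\<in>C. (inner b e / inner b b) *\<^sub>R b)" by (simp add: w_def)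
    also have "\<dots> \<in> span C" by (intro span_sum span_scale span_base)
    finally show False using i by (simp add: e_def)
  qed
  have wC: "orthogonal w c" if "c \<in> C" for c
  proof -
    have "(\<Sum>b\<in>C. inner b e / inner b b * inner b c) = (\<Sum>b\<in>C. if b = c then inner c e else 0)"
      using C(4) that by (intro sum.cong) (auto simp: pairwise_def orthogonal_def)
    then show ?thesis
      using that C(1)
      by (simp add: orthogonal_def w_def inner_diff_left inner_sum_left inner_commute[of e])
  qed
  have wS: "inner w x = 0" if "x \<in> S" for x
    using orthogonal_to_span[of x C w] wC C(3) span_base[OF that] by (auto simp: orthogonal_def)
  show ?thesis
    by (rule bexI[of _ "(\<rho> / norm w) *\<^sub>R w"])
       (use w0 wS wd assms(4) in \<open>auto simp: subspace_scale[OF subspace_Rd]\<close>)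
qed

section \<open>The resisting oracle\<close>

text \<open>Two scales are free: \<open>s\<close> for the values, and the common length of the
  \<open>u i\<close> for the variables.\<close>

definition hard :: "nat \<Rightarrow> real \<Rightarrow> (nat \<Rightarrow> fsvec) \<Rightarrow> fsvec \<Rightarrow> real" where
  "hard N s u x = s * chain N (\<lambda>i. inner (u i) x)"

definition hard_grad :: "nat \<Rightarrow> real \<Rightarrow> (nat \<Rightarrow> fsvec) \<Rightarrow> fsvec \<Rightarrow> fsvec" where
  "hard_grad N s u x = s *\<^sub>R (\<Sum>j<N. chain_partial N (\<lambda>i. inner (u i) x) j *\<^sub>R u j)"

lemma hard_has_derivative:
  "(hard N s u has_derivative (\<lambda>h. inner (hard_grad N s u x) h)) (at x within X)"
proof -
  have "((\<lambda>x. s * chain N (\<lambda>i. inner (u i) x)) has_derivative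
     (\<lambda>h. s * (\<Sum>j<N. chain_partial N (\<lambda>i. inner (u i) x) j * inner (u j) h))) (at x within X)"
    by (intro has_derivative_mult_right chain_has_derivative)
  then show ?thesis
    by (simp add: hard_def[abs_def] hard_grad_def inner_sum_left)
qed

lemma hard_grad_in_Rd: "(\<And>i. u i \<in> Rd d) \<Longrightarrow> hard_grad N s u x \<in> Rd d"
  unfolding hard_grad_def by (intro subspace_sum subspace_scale subspace_Rd)

lemma gradient_eq:
  assumes "x \<in> Rd d" "g \<in> Rd d" "(f has_derivative (\<lambda>h. inner g h)) (at x within Rd d)"
  shows "gradient d f x = g"
  unfolding gradient_def
  using gradient_ex1[of f x d] assms by (intro the1_equality) (auto simp: differentiable_def)

lemma gradient_hard:
  "(\<And>i. u i \<in> Rd d) \<Longrightarrow> x \<in> Rd d \<Longrightarrow> gradient d (hard N s u) x = hard_grad N s u x"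
  by (intro gradient_eq hard_grad_in_Rd hard_has_derivative)

lemma iterate_in_Rd:
  assumes "first_order_method A" "d \<ge> 1" "\<And>x. x \<in> Rd d \<Longrightarrow> gradient d f x \<in> Rd d"
  shows "iterate A d f t \<in> Rd d"
proof -
  have A: "A d tr \<in> Rd d" if "tr \<in> lists (Rd d \<times> UNIV \<times> Rd d)" for tr
    using assms(1,2) that by (simp add: first_order_method_def)
  have "transcript_of A d f t \<in> lists (Rd d \<times> UNIV \<times> Rd d)"
    by (induction t) (use A assms(3) in \<open>auto simp: Let_def\<close>)
  then show ?thesis by (simp add: iterate_def A)
qed

text \<open>Agreement is required only along the run on \<open>f\<close>; determinism then makes the
  run on \<open>g\<close> coincide with it.\<close>

lemma transcript_of_cong:
  assumes "\<And>s. s < t \<Longrightarrow> f (iterate A d f s) = g (iterate A d f s)"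
    and "\<And>s. s < t \<Longrightarrow> gradient d f (iterate A d f s) = gradient d g (iterate A d f s)"
  shows "transcript_of A d g t = transcript_of A d f t"
  using assms by (induction t) (simp_all add: Let_def iterate_def)

text \<open>
  Directions not chosen yet are represented by zero vectors. By the zero-chain property the answers
  given so far do not change when \<open>u n = 0\<close> is replaced by the new direction.
\<close>

lemma resisting_sequence:
  assumes A: "first_order_method A" and d: "d \<ge> 1" "2 * N \<le> d" and \<rho>: "0 \<le> \<rho>"
  shows "n \<le> N \<Longrightarrow> \<exists>u. (\<forall>i. u i \<in> Rd d) \<and> (\<forall>i\<ge>n. u i = 0) \<and> (\<forall>i<n. norm (u i) = \<rho>) \<and>
     (\<forall>i j. i \<noteq> j \<longrightarrow> inner (u i) (u j) = 0) \<and>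
     (\<forall>t<n. \<forall>i\<ge>t. inner (u i) (iterate A d (hard N s u) t) = 0)"
proof (induction n)
  case 0
  show ?case by (rule exI[of _ "\<lambda>_. 0"]) (simp add: Rd_def)
next
  case (Suc n)
  then obtain u where u: "\<And>i. u i \<in> Rd d" "\<And>i. i \<ge> n \<Longrightarrow> u i = 0" "\<And>i. i < n \<Longrightarrow> norm (u i) = \<rho>"
     "\<And>i j. i \<noteq> j \<Longrightarrow> inner (u i) (u j) = 0"
     "\<And>t i. t < n \<Longrightarrow> i \<ge> t \<Longrightarrow> inner (u i) (iterate A d (hard N s u) t) = 0"
    by (metis Suc_leD)
  define x where "x = iterate A d (hard N s u)"
  \<comment> \<open>The query \<open>x n\<close> depends only on answers to earlier queries, so it
    is known before direction \<open>n\<close> is chosen. \<open>S\<close> has at most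
    \<open>2 * n + 1 < 2 * N\<close> elements.\<close>
  define S where "S = u ` {..<n} \<union> x ` {..n}"
  have x: "x t \<in> Rd d" for t
    unfolding x_def by (intro iterate_in_Rd A d) (simp add: gradient_hard hard_grad_in_Rd u(1))
  have "card S \<le> card (u ` {..<n}) + card (x ` {..n})"
    unfolding S_def by (rule card_Un_le)
  also have "\<dots> \<le> n + Suc n"
    using card_image_le[of "{..<n}" u] card_image_le[of "{..n}" x] by simp
  also have "\<dots> < d" using Suc.prems d by simp
  finally obtain v where v: "v \<in> Rd d" "norm v = \<rho>" "\<And>y. y \<in> S \<Longrightarrow> inner v y = 0"
    using Rd_orthogonal_exists[of S d \<rho>] x u(1) \<rho> by (auto simp: S_def)
  define u' where "u' = u(n := v)"
  have u'd: "u' i \<in> Rd d" for i using u v by (simp add: u'_def)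
  \<comment> \<open>At index \<open>n\<close> both sides are 0: the old direction is zero and the
    new one is orthogonal to \<open>x t\<close>.\<close>
  have inner_eq: "inner (u' i) (x t) = inner (u i) (x t)" if "t \<le> n" for i t
    using that v(3)[of "x t"] u(2)[of n] by (auto simp: u'_def S_def)
  \<comment> \<open>Strictness matters: the answer at \<open>x n\<close> may reveal direction
    \<open>n\<close>, but it influences only later queries.\<close>
  have grad_eq: "hard_grad N s u' (x t) = hard_grad N s u (x t)" if "t < n" for t
  proof -
    have "chain_partial N (\<lambda>i. inner (u i) (x t)) n = 0"
      by (rule chain_partial_zero_tail[OF _ that]) (use u(5)[OF that] in \<open>simp add: x_def\<close>)
    then have "chain_partial N (\<lambda>i. inner (u i) (x t)) j *\<^sub>R u' j
        = chain_partial N (\<lambda>i. inner (u i) (x t)) j *\<^sub>R u j" for j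
      by (simp add: u'_def)
    then have "(\<Sum>j<N. chain_partial N (\<lambda>i. inner (u i) (x t)) j *\<^sub>R u' j)
        = (\<Sum>j<N. chain_partial N (\<lambda>i. inner (u i) (x t)) j *\<^sub>R u j)"
      by (intro sum.cong refl)
    then show ?thesis using that by (simp add: hard_grad_def inner_eq)
  qed
  have it: "iterate A d (hard N s u') t = x t" if "t \<le> n" for t
  proof -
    have "transcript_of A d (hard N s u') t = transcript_of A d (hard N s u) t"
      by (rule transcript_of_cong)
        (use that x in \<open>auto simp: x_def[symmetric] hard_def inner_eq gradient_hard u(1) u'd grad_eq\<close>)
    then show ?thesis by (simp add: iterate_def x_def)
  qed
  have orth: "inner (u' i) (u' j) = 0" if "i \<noteq> j" for i j
  proof -
    have "inner v (u k) = 0" if "k \<noteq> n" for k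
      using that v(3)[of "u k"] u(2)[of k] by (cases "k < n") (auto simp: S_def)
    then show ?thesis using that u(4) by (auto simp: u'_def inner_commute)
  qed
  have tail: "inner (u' i) (x t) = 0" if "t \<le> n" "i \<ge> t" for i t
    using that inner_eq[OF that(1), of i] u(5)[of t i] u(2)[of i] by (cases "t < n") (auto simp: x_def)
  show ?case
  proof (intro exI[of _ u'] conjI allI impI)
    show "u' i = 0" if "Suc n \<le> i" for i using that u(2) by (simp add: u'_def)
    show "norm (u' i) = \<rho>" if "i < Suc n" for i using that u(3) v(2) by (simp add: u'_def)
    show "inner (u' i) (iterate A d (hard N s u') t) = 0" if "t < Suc n" "t \<le> i" for i t
      using that tail by (simp add: it)
  qed (simp_all add: u'd orth)
qed

section \<open>The hard instance and the lower bound\<close>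

text \<open>Split \<open>F = F powr (\<alpha> / 2) * F powr (1 - \<alpha> / 2)\<close>: the
  quadratic inequality bounds the first factor by \<open>G powr \<alpha>\<close> up to
  \<open>\<mu>\<close>, and \<open>F \<le> B\<close> bounds the second.\<close>

lemma gradient_domination_powr:
  fixes F G B \<mu> \<tau> \<alpha> :: real
  assumes "0 \<le> F" "F \<le> B" "\<mu> * F \<le> G\<^sup>2" "0 \<le> G" "0 < \<mu>" "0 < \<alpha>" "\<alpha> < 2" "0 \<le> \<tau>"
    and "B powr (1 - \<alpha> / 2) \<le> \<tau> * \<mu> powr (\<alpha> / 2)"
  shows "F \<le> \<tau> * G powr \<alpha>"
proof (cases "F = 0")
  case True
  then show ?thesis using assms by simp
next
  case False
  then have F: "F > 0" using assms by simp
  then have "0 < \<mu> * F" using assms by simp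
  then have G: "G > 0" using assms by (cases "G = 0") auto
  have "\<mu> powr (\<alpha> / 2) * F = (\<mu> * F) powr (\<alpha> / 2) * F powr (1 - \<alpha> / 2)"
    using F assms by (simp add: powr_mult powr_add[symmetric])
  also have "\<dots> \<le> (G\<^sup>2) powr (\<alpha> / 2) * B powr (1 - \<alpha> / 2)"
    using F assms by (intro mult_mono powr_mono2) auto
  also have "(G\<^sup>2) powr (\<alpha> / 2) = G powr \<alpha>"
    using G powr_powr[of G 2 "\<alpha> / 2"] by simp
  also have "G powr \<alpha> * B powr (1 - \<alpha> / 2) \<le> G powr \<alpha> * (\<tau> * \<mu> powr (\<alpha> / 2))"
    using assms by (intro mult_left_mono) auto
  finally have "\<mu> powr (\<alpha> / 2) * F \<le> \<mu> powr (\<alpha> / 2) * (\<tau> * G powr \<alpha>)"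
    by (simp add: algebra_simps)
  then show ?thesis using assms(5) by simp
qed

lemma inf_value_hard:
  assumes "\<And>i. u i \<in> Rd d" "\<And>i j. i \<noteq> j \<Longrightarrow> inner (u i) (u j) = 0"
    "\<And>i. i < N \<Longrightarrow> norm (u i) = \<rho>" "0 < \<rho>" "0 \<le> s"
  shows "inf_value d (hard N s u) = 0"
proof -
  \<comment> \<open>The coefficient makes every inner product with a direction \<open>u k\<close>,
    \<open>k < N\<close>, equal to 1, the minimiser of the chain.\<close>
  define x where "x = (\<Sum>j<N. (1 / \<rho>\<^sup>2) *\<^sub>R u j)"
  have x: "x \<in> Rd d"
    unfolding x_def by (intro subspace_sum subspace_scale subspace_Rd assms)
  have "hard N s u x = s * chain N (\<lambda>_. 1)"
    unfolding hard_def x_def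
    by (intro arg_cong[of _ _ "(*) s"] chain_cong) (subst inner_sum_orthogonal[OF assms(2,3)]; use assms(4) in simp)
  then have 0: "hard N s u x = 0" by (simp add: chain_1)
  have nn: "0 \<le> hard N s u y" for y
    using assms(5) by (simp add: hard_def chain_nonneg)
  show ?thesis
    unfolding inf_value_def
  proof (rule antisym)
    show "(INF x\<in>Rd d. hard N s u x) \<le> 0"
      using x 0 nn by (metis bdd_belowI2 cINF_lower)
    show "0 \<le> (INF x\<in>Rd d. hard N s u x)"
      using x nn by (intro cINF_greatest) auto
  qed
qed

text \<open>Scaling turns the chain's Lipschitz constant 10 into
  \<open>10 * s * \<rho>\<^sup>2 = L\<close> and its constant \<open>1 / (26 * N)\<close> into
  \<open>s * \<rho>\<^sup>2 / (26 * N) = L / (260 * N)\<close>. On the sublevel set values are at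
  most \<open>s * N\<close>, the bound \<open>B\<close> of
  \<open>gradient_domination_powr\<close>.\<close>

lemma hard_in_func_class:
  assumes u: "\<And>i. u i \<in> Rd d" "\<And>i j. i \<noteq> j \<Longrightarrow> inner (u i) (u j) = 0"
    "\<And>i. i < N \<Longrightarrow> norm (u i) = \<rho>" and "0 < \<rho>" "0 < s" "1 \<le> N"
    and L: "10 * s * \<rho>\<^sup>2 = L" and B: "s * real N \<le> \<Delta>\<^sub>0"
    and \<alpha>: "0 < \<alpha>" "\<alpha> < 2" and "0 \<le> \<tau>"
    and \<tau>: "(s * real N) powr (1 - \<alpha> / 2) \<le> \<tau> * (L / (260 * real N)) powr (\<alpha> / 2)"
  shows "hard N s u \<in> func_class \<alpha> L \<tau> \<Delta>\<^sub>0 d"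
proof -
  let ?f = "hard N s u"
  define z where "z x i = inner (u i) x" for x i
  have inf: "inf_value d ?f = 0"
    by (rule inf_value_hard[OF u]) (use assms in auto)
  have nn: "0 \<le> ?f y" for y
    using assms(5) by (simp add: hard_def chain_nonneg)
  have f0: "?f 0 \<le> s * real N"
    using assms(5) chain_0_le[of N] by (simp add: hard_def)
  have Lip: "norm (hard_grad N s u x - hard_grad N s u y) \<le> L * norm (x - y)" for x y
  proof (rule power2_le_imp_le)
    have "(norm (hard_grad N s u x - hard_grad N s u y))\<^sup>2
        = s\<^sup>2 * (norm (\<Sum>j<N. (chain_partial N (z x) j - chain_partial N (z y) j) *\<^sub>R u j))\<^sup>2"
      unfolding hard_grad_def scaleR_diff_right[symmetric] sum_subtractf[symmetric] scaleR_diff_left[symmetric]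
      by (simp add: z_def[abs_def] power_mult_distrib)
    also have "\<dots> = s\<^sup>2 * (\<rho>\<^sup>2 * (\<Sum>j<N. (chain_partial N (z x) j - chain_partial N (z y) j)\<^sup>2))"
      by (subst norm_sum_orthogonal[OF u(2,3)]) auto
    also have "\<dots> \<le> s\<^sup>2 * (\<rho>\<^sup>2 * (100 * (\<Sum>j<N. (z x j - z y j)\<^sup>2)))"
      by (intro mult_left_mono chain_partial_lipschitz) auto
    also have "(\<Sum>j<N. (z x j - z y j)\<^sup>2) = (\<Sum>j<N. (inner (u j) (x - y))\<^sup>2)"
      by (simp add: z_def inner_diff_right)
    also have "s\<^sup>2 * (\<rho>\<^sup>2 * (100 * (\<Sum>j<N. (inner (u j) (x - y))\<^sup>2)))
        \<le> s\<^sup>2 * (\<rho>\<^sup>2 * (100 * (\<rho>\<^sup>2 * (norm (x - y))\<^sup>2)))"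
      using assms(4) by (intro mult_left_mono bessel_orthogonal u) auto
    also have "\<dots> = (L * norm (x - y))\<^sup>2"
      unfolding L[symmetric] by (simp add: power2_eq_square)
    finally show "(norm (hard_grad N s u x - hard_grad N s u y))\<^sup>2 \<le> (L * norm (x - y))\<^sup>2" .
    show "0 \<le> L * norm (x - y)" using assms(5) by (auto simp: L[symmetric])
  qed
  have PL: "L / (260 * real N) * ?f x \<le> (norm (hard_grad N s u x))\<^sup>2" for x
  proof -
    have "L / (260 * real N) * ?f x \<le> L / (260 * real N) * (s * (26 * real N * (\<Sum>j<N. (chain_partial N (z x) j)\<^sup>2)))"
      unfolding hard_def z_def using assms(5) L[symmetric]
      by (intro mult_left_mono chain_le_partials) auto
    also have "\<dots> = s\<^sup>2 * (\<rho>\<^sup>2 * (\<Sum>j<N. (chain_partial N (z x) j)\<^sup>2))"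
      using assms(6) by (simp add: L[symmetric] power2_eq_square field_simps)
    also have "\<dots> = (norm (hard_grad N s u x))\<^sup>2"
      by (simp add: hard_grad_def z_def[abs_def] power_mult_distrib norm_sum_orthogonal[OF u(2,3)])
    finally show ?thesis .
  qed
  show ?thesis
    unfolding func_class_def mem_Collect_eq inf
  proof (intro conjI ballI)
    show "?f differentiable_on Rd d"
      by (auto simp: differentiable_on_def differentiable_def intro: hard_has_derivative)
    show "bdd_below (?f ` Rd d)" using nn by (intro bdd_belowI2) auto
    show "?f 0 - 0 \<le> \<Delta>\<^sub>0" using f0 B by simp
    show "L-lipschitz_on (Rd d) (gradient d ?f)"
      using Lip assms(5) by (intro lipschitz_onI) (auto simp: gradient_hard u(1) dist_norm L[symmetric])
    fix x assume "x \<in> sublevel0 d ?f"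
    then have x: "x \<in> Rd d" "?f x \<le> ?f 0" by (auto simp: sublevel0_def)
    have "?f x \<le> \<tau> * norm (hard_grad N s u x) powr \<alpha>"
      by (rule gradient_domination_powr[OF _ _ PL _ _ _ _ _ \<tau>])
        (use nn x f0 assms in \<open>auto simp: L[symmetric]\<close>)
    then show "?f x - 0 \<le> \<tau> * norm (gradient d ?f x) powr \<alpha>"
      by (simp add: gradient_hard u(1) x)
  qed
qed

text \<open>The total height 4\<epsilon> is spread evenly over \<open>N\<close> links, and at least
  half of them are still unpaid at query \<open>T\<close>.\<close>

lemma minimax_error_ge:
  assumes "0 < L" "0 < \<tau>" "0 < \<epsilon>" "1 \<le> \<alpha>" "\<alpha> < 2" "4 * \<epsilon> \<le> \<Delta>\<^sub>0"
    and N: "real N \<le> L * \<tau> powr (2 / \<alpha>) * \<epsilon> powr (- (2 - \<alpha>) / \<alpha>) / 1040"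
    and T: "1 \<le> N" "2 * (T + 1) \<le> N"
  shows "ereal (2 * \<epsilon>) \<le> minimax_error \<alpha> L \<tau> \<Delta>\<^sub>0 T"
  unfolding minimax_error_def
proof (rule INF_greatest)
  fix A assume "A \<in> {A. first_order_method A}"
  then have A: "first_order_method A" by simp
  define s where "s = 4 * \<epsilon> / real N"
  define \<rho> where "\<rho> = sqrt (L / (10 * s))"
  have s: "0 < s" "s * real N = 4 * \<epsilon>" and \<rho>: "0 < \<rho>" "10 * s * \<rho>\<^sup>2 = L"
    using assms by (auto simp: s_def \<rho>_def)
  define d where "d = 2 * N"
  have d: "d \<ge> 1" "2 * N \<le> d" using T by (auto simp: d_def)
  obtain u where u: "\<And>i. u i \<in> Rd d" "\<And>i. i \<ge> N \<Longrightarrow> u i = 0" "\<And>i. i < N \<Longrightarrow> norm (u i) = \<rho>"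
     "\<And>i j. i \<noteq> j \<Longrightarrow> inner (u i) (u j) = 0"
     "\<And>t i. t < N \<Longrightarrow> i \<ge> t \<Longrightarrow> inner (u i) (iterate A d (hard N s u) t) = 0"
    using resisting_sequence[OF A d, of \<rho> N s] \<rho>(1) by (metis le_refl less_imp_le)
  let ?f = "hard N s u"
  \<comment> \<open>The bound on \<open>N\<close> with 1040 = 4 * 260, solved for
    \<open>L / (260 * N)\<close> and raised to the power \<alpha>/2.\<close>
  have rate: "(4 * \<epsilon>) powr (1 - \<alpha> / 2) \<le> \<tau> * (L / (260 * real N)) powr (\<alpha> / 2)"
  proof -
    have e: "\<epsilon> powr (- (2 - \<alpha>) / \<alpha>) * \<epsilon> powr ((2 - \<alpha>) / \<alpha>) = 1"
      "\<tau> powr (2 / \<alpha>) * \<tau> powr (- 2 / \<alpha>) = 1"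
      using assms by (simp_all add: powr_add[symmetric] add_divide_distrib[symmetric])
    have "4 * (\<tau> powr (- 2 / \<alpha>) * \<epsilon> powr ((2 - \<alpha>) / \<alpha>)) * (260 * real N)
        \<le> 4 * (\<tau> powr (- 2 / \<alpha>) * \<epsilon> powr ((2 - \<alpha>) / \<alpha>))
          * (260 * (L * \<tau> powr (2 / \<alpha>) * \<epsilon> powr (- (2 - \<alpha>) / \<alpha>) / 1040))"
      using N by (intro mult_left_mono) auto
    also have "\<dots> = L * (\<epsilon> powr (- (2 - \<alpha>) / \<alpha>) * \<epsilon> powr ((2 - \<alpha>) / \<alpha>))
        * (\<tau> powr (2 / \<alpha>) * \<tau> powr (- 2 / \<alpha>))" by simp
    also have "\<dots> = L" unfolding e by simp
    finally have "4 * (\<tau> powr (- 2 / \<alpha>) * \<epsilon> powr ((2 - \<alpha>) / \<alpha>)) \<le> L / (260 * real N)"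
      using T by (simp add: field_simps)
    then have "(4 * (\<tau> powr (- 2 / \<alpha>) * \<epsilon> powr ((2 - \<alpha>) / \<alpha>))) powr (\<alpha> / 2)
        \<le> (L / (260 * real N)) powr (\<alpha> / 2)"
      using assms by (intro powr_mono2) auto
    moreover have "(4 * (\<tau> powr (- 2 / \<alpha>) * \<epsilon> powr ((2 - \<alpha>) / \<alpha>))) powr (\<alpha> / 2)
        = 4 powr (\<alpha> / 2) * (\<tau> powr (-1) * \<epsilon> powr (1 - \<alpha> / 2))"
    proof -
      have "- 2 / \<alpha> * (\<alpha> / 2) = -1" "(2 - \<alpha>) / \<alpha> * (\<alpha> / 2) = 1 - \<alpha> / 2"
        using assms by (simp_all add: field_simps)
      then show ?thesis by (simp only: powr_mult powr_powr)
    qed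
    ultimately have "\<tau> * (4 powr (\<alpha> / 2) * (\<tau> powr (-1) * \<epsilon> powr (1 - \<alpha> / 2)))
        \<le> \<tau> * (L / (260 * real N)) powr (\<alpha> / 2)"
      using assms(2) by (simp only: mult_left_mono less_imp_le)
    moreover have "\<tau> * (4 powr (\<alpha> / 2) * (\<tau> powr (-1) * \<epsilon> powr (1 - \<alpha> / 2)))
        = 4 powr (\<alpha> / 2) * \<epsilon> powr (1 - \<alpha> / 2)"
      using assms by (simp add: powr_minus field_simps)
    \<comment> \<open>Here \<alpha> \<ge> 1 enters, as 1 - \<alpha>/2 \<le> \<alpha>/2.\<close>
    moreover have "(4 * \<epsilon>) powr (1 - \<alpha> / 2) \<le> 4 powr (\<alpha> / 2) * \<epsilon> powr (1 - \<alpha> / 2)"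
      using assms(4) unfolding powr_mult by (intro mult_right_mono powr_mono) auto
    ultimately show ?thesis by linarith
  qed
  have mem: "?f \<in> func_class \<alpha> L \<tau> \<Delta>\<^sub>0 d"
    by (rule hard_in_func_class[OF u(1,4,3) \<rho>(1) s(1) T(1) \<rho>(2)]) (use assms s(2) rate in auto)
  have inf: "inf_value d ?f = 0"
    by (rule inf_value_hard[OF u(1,4,3) \<rho>(1)]) (use s in auto)
  have "2 * \<epsilon> = s * (real N / 2)" using s(2) by simp
  also have "\<dots> \<le> s * (real N - real T - 1)"
  proof (intro mult_left_mono)
    have "real (2 * (T + 1)) \<le> real N" using T(2) by (simp only: of_nat_le_iff)
    then show "real N / 2 \<le> real N - real T - 1" by simp
  qed (use s in simp)
  also have "\<dots> \<le> ?f (iterate A d ?f T)"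
    unfolding hard_def[of N s u "iterate A d ?f T"]
    by (intro mult_left_mono chain_ge_zero_tail u(5)) (use s T in auto)
  finally have "ereal (2 * \<epsilon>) \<le> ereal (?f (iterate A d ?f T) - inf_value d ?f)"
    by (simp add: inf)
  also have "\<dots> \<le> (SUP f\<in>func_class \<alpha> L \<tau> \<Delta>\<^sub>0 d. ereal (f (iterate A d f T) - inf_value d f))"
    by (rule SUP_upper[OF mem])
  also have "\<dots> \<le> (SUP d\<in>{1..}. SUP f\<in>func_class \<alpha> L \<tau> \<Delta>\<^sub>0 d. ereal (f (iterate A d f T) - inf_value d f))"
    by (rule SUP_upper) (use d in auto)
  finally show "ereal (2 * \<epsilon>) \<le> \<dots>" .
qed

theorem theorem3p1:
  fixes \<alpha> :: real
  assumes "1 \<le> \<alpha>" "\<alpha> < 2"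
  shows "\<exists>c>0. \<forall>L \<tau> \<Delta>\<^sub>0 \<epsilon> :: real.
    L > 0 \<longrightarrow> \<tau> > 0 \<longrightarrow> \<Delta>\<^sub>0 > 0 \<longrightarrow> \<epsilon> > 0 \<longrightarrow>
    \<epsilon> \<le> c * min \<Delta>\<^sub>0 (L powr (\<alpha> / (2 - \<alpha>)) * \<tau> powr (2 / (2 - \<alpha>))) \<longrightarrow>
    ereal_of_enat (oracle_complexity \<alpha> L \<tau> \<Delta>\<^sub>0 \<epsilon>)
      \<ge> ereal (c * L * \<tau> powr (2 / \<alpha>) * \<epsilon> powr (- (2 - \<alpha>) / \<alpha>))"
proof -
  \<comment> \<open>8320 = 8 * 1040. The first bound makes \<open>T < c * K\<close> imply
    \<open>8 * T < K / 1040\<close>; the second, raised to (2 - \<alpha>)/\<alpha>, is 1/8320 and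
    yields \<open>K \<ge> 8320\<close>, so at least 8 links fit.\<close>
  define c :: real where "c = min (1 / 8320) (8320 powr (- \<alpha> / (2 - \<alpha>)))"
  have c: "0 < c" "c \<le> 1 / 8320" "c \<le> 8320 powr (- \<alpha> / (2 - \<alpha>))" by (auto simp: c_def)
  show ?thesis
  proof (intro exI[of _ c] conjI allI impI)
    fix L \<tau> \<Delta>\<^sub>0 \<epsilon> :: real
    assume pos: "0 < L" "0 < \<tau>" "0 < \<Delta>\<^sub>0" "0 < \<epsilon>"
      and \<epsilon>: "\<epsilon> \<le> c * min \<Delta>\<^sub>0 (L powr (\<alpha> / (2 - \<alpha>)) * \<tau> powr (2 / (2 - \<alpha>)))"
    define K where "K = L * \<tau> powr (2 / \<alpha>) * \<epsilon> powr (- (2 - \<alpha>) / \<alpha>)"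
    have "\<epsilon> \<le> c * \<Delta>\<^sub>0"
      using \<epsilon> c by (smt (verit) mult_left_mono)
    also have "\<dots> \<le> 1/4 * \<Delta>\<^sub>0"
      using c pos by (intro mult_right_mono) auto
    finally have \<epsilon>\<Delta>: "4 * \<epsilon> \<le> \<Delta>\<^sub>0" by simp
    have K: "8320 \<le> K"
    proof -
      have "\<epsilon> \<le> c * (L powr (\<alpha> / (2 - \<alpha>)) * \<tau> powr (2 / (2 - \<alpha>)))"
        using \<epsilon> c by (smt (verit) mult_left_mono)
      also have "\<dots> \<le> 8320 powr (- \<alpha> / (2 - \<alpha>)) * (L powr (\<alpha> / (2 - \<alpha>)) * \<tau> powr (2 / (2 - \<alpha>)))"
        using c by (intro mult_right_mono) auto
      finally have "\<epsilon> powr ((2 - \<alpha>) / \<alpha>) \<le>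
          (8320 powr (- \<alpha> / (2 - \<alpha>)) * (L powr (\<alpha> / (2 - \<alpha>)) * \<tau> powr (2 / (2 - \<alpha>)))) powr ((2 - \<alpha>) / \<alpha>)"
        using assms pos by (intro powr_mono2) auto
      also have "\<dots> = 8320 powr (-1) * (L * \<tau> powr (2 / \<alpha>))"
      proof -
        have e: "- \<alpha> / (2 - \<alpha>) * ((2 - \<alpha>) / \<alpha>) = -1" "\<alpha> / (2 - \<alpha>) * ((2 - \<alpha>) / \<alpha>) = 1"
          "2 / (2 - \<alpha>) * ((2 - \<alpha>) / \<alpha>) = 2 / \<alpha>"
          using assms by (simp_all add: divide_simps)
        show ?thesis
          using pos by (simp only: powr_mult powr_powr e powr_one less_imp_le)
      qed
      finally have "8320 * \<epsilon> powr ((2 - \<alpha>) / \<alpha>) \<le> L * \<tau> powr (2 / \<alpha>)"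
        by (simp add: powr_minus)
      moreover have "K = L * \<tau> powr (2 / \<alpha>) / \<epsilon> powr ((2 - \<alpha>) / \<alpha>)"
        unfolding K_def minus_divide_left[symmetric] powr_minus by (simp add: divide_inverse)
      ultimately show ?thesis using pos by (simp add: pos_le_divide_eq)
    qed
    have *: "c * K \<le> real T" if T: "minimax_error \<alpha> L \<tau> \<Delta>\<^sub>0 T \<le> ereal \<epsilon>" for T
    proof (rule ccontr)
      assume "\<not> c * K \<le> real T"
      then have "real T < c * K" by simp
      also have "c * K \<le> 1 / 8320 * K" using c K by (intro mult_right_mono) auto
      finally have TK: "real T < K / 8320" by simp
      \<comment> \<open>The longest chain that \<open>minimax_error_ge\<close> admits; it has room
        for \<open>T\<close> queries and leaves an error of 2\<epsilon>, contradicting the choice of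
        \<open>T\<close>.\<close>
      define N where "N = nat \<lfloor>K / 1040\<rfloor>"
      have N: "real N \<le> K / 1040" "K / 1040 < real N + 1"
        using K of_int_floor_le[of "K / 1040"] real_of_int_floor_add_one_gt[of "K / 1040"]
        unfolding N_def by simp_all
      have "2 * (T + 1) \<le> N"
      proof -
        have "8 * real T < real (N + 1)" using TK N by simp
        then have "8 * T < N + 1" by linarith
        moreover have "8 < real N + 1" using K N by linarith
        then have "8 \<le> N" by linarith
        ultimately show ?thesis by simp
      qed
      then have "ereal (2 * \<epsilon>) \<le> minimax_error \<alpha> L \<tau> \<Delta>\<^sub>0 T"
        using pos assms \<epsilon>\<Delta> N by (intro minimax_error_ge[of _ _ _ _ _ N]) (auto simp: K_def)
      with T have "ereal (2 * \<epsilon>) \<le> ereal \<epsilon>" by (rule order_trans[rotated])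
      then show False using pos by simp
    qed
    \<comment> \<open>The real bound is rounded up to compare it with an infimum in
      \<open>enat\<close>; this also covers the case of no sufficient budget.\<close>
    have "enat (nat \<lceil>c * K\<rceil>) \<le> oracle_complexity \<alpha> L \<tau> \<Delta>\<^sub>0 \<epsilon>"
      unfolding oracle_complexity_def using * by (intro INF_greatest) (simp add: ceiling_le_iff nat_le_iff)
    then have "ereal_of_enat (enat (nat \<lceil>c * K\<rceil>)) \<le> ereal_of_enat (oracle_complexity \<alpha> L \<tau> \<Delta>\<^sub>0 \<epsilon>)"
      by (simp only: ereal_of_enat_le_iff)
    moreover have "c * K \<le> real (nat \<lceil>c * K\<rceil>)" by (rule real_nat_ceiling_ge)
    then have "ereal (c * K) \<le> ereal_of_enat (enat (nat \<lceil>c * K\<rceil>))" by simp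
    ultimately have "ereal (c * K) \<le> ereal_of_enat (oracle_complexity \<alpha> L \<tau> \<Delta>\<^sub>0 \<epsilon>)"
      by (rule order_trans[rotated])
    then show "ereal (c * L * \<tau> powr (2 / \<alpha>) * \<epsilon> powr (- (2 - \<alpha>) / \<alpha>))
        \<le> ereal_of_enat (oracle_complexity \<alpha> L \<tau> \<Delta>\<^sub>0 \<epsilon>)"
      by (simp add: K_def mult.assoc)
  qed (rule c)
qed

end
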